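(* Let $A \in \mathbb{R}^{m\times n}$, let $X \in \mathbb{R}^{n \times q}$ with $q < n$, and let $\|\cdot\|_*$ be any matrix norm on $\mathbb{R}^{m \times n}$. Then, for every $\delta > 0$, there exists $B \in \mathbb{R}^{m \times n}$ such that $BX = AX$ but $$\|B\|_* \ge \delta.$$
   Context: A matrix norm here means any norm on the vector space $\mathbb{R}^{m\times n}$ (for example the spectral, Frobenius, or Schatten norms); $m, n \geq 1$. *)

theory Defs
  imports Complex_Main "Jordan_Normal_Form.Matrix"
begin

text \<open>
  An arbitrary norm on the real vector space of \<open>m \<times> n\<close> matrices. Neither submultiplicativity
  nor any invariance is required, and the values of \<open>N\<close> outside
  \<^term>\<open>carrier_mat m n\<close> are irrelevant.
\<close>

definition matrix_norm :: "nat \<Rightarrow> nat \<Rightarrow> (real mat \<Rightarrow> real) \<Rightarrow> bool" where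
  "matrix_norm m n N \<longleftrightarrow>
     (\<forall>A \<in> carrier_mat m n. 0 \<le> N A) \<and>
     (\<forall>A \<in> carrier_mat m n. N A = 0 \<longleftrightarrow> A = 0\<^sub>m m n) \<and>
     (\<forall>c. \<forall>A \<in> carrier_mat m n. N (c \<cdot>\<^sub>m A) = \<bar>c\<bar> * N A) \<and>
     (\<forall>A \<in> carrier_mat m n. \<forall>B \<in> carrier_mat m n. N (A + B) \<le> N A + N B)"

end

theory Submission
  imports Defs "Jordan_Normal_Form.Determinant"
begin

text \<open>
  Since \<open>q < n\<close>, some nonzero vector \<open>v\<close> is orthogonal to all columns of \<open>X\<close>.
  The matrix \<open>D\<close> all of whose rows are \<open>v\<close> then satisfies \<open>D X = 0\<close>, so adding large
  multiples of \<open>D\<close> to \<open>A\<close> makes the norm grow without changing the product with \<open>X\<close>.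
\<close>

lemma underdetermined_nonzero_solution:
  fixes M :: "'a :: field mat"
  assumes M: "M \<in> carrier_mat q n" and "q < n"
  obtains v where "v \<in> carrier_vec n" "v \<noteq> 0\<^sub>v n" "M *\<^sub>v v = 0\<^sub>v q"
proof -
  \<comment> \<open>Padding \<open>M\<close> with zero rows gives a singular square matrix.\<close>
  define S where "S = mat\<^sub>r n n (\<lambda>i. if i = q then 0\<^sub>v n else if i < q then row M i else 0\<^sub>v n)"
  have S: "S \<in> carrier_mat n n"
    by (simp add: S_def)
  \<comment> \<open>Row \<open>q\<close> exists because \<open>q < n\<close>, and it is zero.
    Splitting off the case \<open>i = q\<close> in \<open>S\<close> gives it the form that
    \<open>det_row_0\<close> expects.\<close>
  have "det S = 0"
    unfolding S_def using M \<open>q < n\<close> by (intro det_row_0) auto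
  then obtain v where v: "v \<in> carrier_vec n" "v \<noteq> 0\<^sub>v n" "S *\<^sub>v v = 0\<^sub>v n"
    using det_0_iff_vec_prod_zero_field[OF S] by blast
  have "M *\<^sub>v v = 0\<^sub>v q"
  proof (rule eq_vecI)
    fix i assume "i < dim_vec (0\<^sub>v q :: 'a vec)"
    then have i: "i < q" by simp
    \<comment> \<open>The first \<open>q\<close> rows of \<open>S\<close> are those of
      \<open>M\<close>, so a kernel vector of \<open>S\<close> is one of \<open>M\<close>.\<close>
    have "row M i = row S i"
      using i M \<open>q < n\<close> by (auto simp: S_def)
    then have "(M *\<^sub>v v) $ i = (S *\<^sub>v v) $ i"
      using i M S \<open>q < n\<close> by simp
    then show "(M *\<^sub>v v) $ i = 0\<^sub>v q $ i"
      using i v(3) \<open>q < n\<close> by simp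
  qed (use M in simp)
  with v show thesis
    using that by blast
qed

text \<open>A matrix annihilates \<open>X\<close> from the left iff each of its rows lies in the
  kernel of the transpose of \<open>X\<close>, a system of \<open>q\<close> equations in
  \<open>n > q\<close> unknowns.\<close>

lemma nonzero_left_annihilator:
  fixes X :: "'a :: field mat"
  assumes X: "X \<in> carrier_mat n q" and "q < n" and "m \<ge> 1"
  obtains D where "D \<in> carrier_mat m n" "D \<noteq> 0\<^sub>m m n" "D * X = 0\<^sub>m m q"
proof -
  obtain v where v: "v \<in> carrier_vec n" "v \<noteq> 0\<^sub>v n" "transpose_mat X *\<^sub>v v = 0\<^sub>v q"
    using underdetermined_nonzero_solution[of "transpose_mat X" q n] X \<open>q < n\<close> by auto
  define D where "D = mat m n (\<lambda>(i, j). v $ j)"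
  have D: "D \<in> carrier_mat m n"
    by (simp add: D_def)
  have row: "row D i = v" if "i < m" for i
    using that v(1) by (auto simp: D_def)
  \<comment> \<open>As \<open>m \<ge> 1\<close>, \<open>D\<close> has a row 0, and this row is the
    nonzero vector \<open>v\<close>.\<close>
  have "D \<noteq> 0\<^sub>m m n"
    using row[of 0] v(2) \<open>m \<ge> 1\<close> by auto
  moreover have "D * X = 0\<^sub>m m q"
  proof (rule eq_matI)
    fix i k assume "i < dim_row (0\<^sub>m m q :: 'a mat)" "k < dim_col (0\<^sub>m m q :: 'a mat)"
    then have ik: "i < m" "k < q" by simp_all
    have "(D * X) $$ (i, k) = v \<bullet> col X k"
      using ik D X by (simp add: row)
    also have "\<dots> = col X k \<bullet> v"
      using v(1) X ik by (intro comm_scalar_prod[of _ n]) auto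
    also have "\<dots> = (transpose_mat X *\<^sub>v v) $ k"
      using ik X by simp
    finally show "(D * X) $$ (i, k) = 0\<^sub>m m q $$ (i, k)"
      using ik v(3) by simp
  qed (use D X in auto)
  ultimately show thesis
    using that D by blast
qed

theorem proposition4p5:
  fixes m n q :: nat and A X :: "real mat" and N :: "real mat \<Rightarrow> real"
  assumes "m \<ge> 1" and "n \<ge> 1"
    and "A \<in> carrier_mat m n"
    and "X \<in> carrier_mat n q" and "q < n"
    and "matrix_norm m n N"
  shows "\<forall>\<delta>>0. \<exists>B \<in> carrier_mat m n. B * X = A * X \<and> N B \<ge> \<delta>"
proof (intro allI impI)
  fix \<delta> :: real assume "\<delta> > 0"
  note A = assms(3) and X = assms(4)
  obtain D where D: "D \<in> carrier_mat m n" "D \<noteq> 0\<^sub>m m n" "D * X = 0\<^sub>m m q"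
    using nonzero_left_annihilator[OF X \<open>q < n\<close> \<open>m \<ge> 1\<close>] by blast
  have nonneg: "0 \<le> N C" and zero_iff: "N C = 0 \<longleftrightarrow> C = 0\<^sub>m m n"
    and smult: "N (c \<cdot>\<^sub>m C) = \<bar>c\<bar> * N C"
    if "C \<in> carrier_mat m n" for c C
    using \<open>matrix_norm m n N\<close> that unfolding matrix_norm_def by blast+
  have triangle: "N (C + E) \<le> N C + N E"
    if "C \<in> carrier_mat m n" "E \<in> carrier_mat m n" for C E
    using \<open>matrix_norm m n N\<close> that unfolding matrix_norm_def by blast
  have "N D > 0"
    using nonneg[OF D(1)] zero_iff[OF D(1)] D(2) by linarith
  \<comment> \<open>Chosen so that \<open>c \<cdot>\<^sub>m D\<close> has norm exactly
    \<open>\<delta> + N A\<close>; the term \<open>N A\<close> pays for what adding \<open>A\<close>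
    can cancel.\<close>
  define c where "c = (\<delta> + N A) / N D"
  have c: "\<bar>c\<bar> * N D = \<delta> + N A"
    using \<open>N D > 0\<close> \<open>\<delta> > 0\<close> nonneg[OF A] by (simp add: c_def)
  define B where "B = A + c \<cdot>\<^sub>m D"
  have B: "B \<in> carrier_mat m n"
    using A D(1) by (simp add: B_def)
  have "B * X = A * X + c \<cdot>\<^sub>m (D * X)"
    using A D(1) X by (simp add: B_def add_mult_distrib_mat[of _ m n]
        mult_smult_assoc_mat[of _ m n _ q])
  also have "\<dots> = A * X"
    using A X by (simp add: D(3))
  finally have "B * X = A * X" .
  moreover have "\<delta> \<le> N B"
  proof -
    \<comment> \<open>Reverse triangle inequality: \<open>B - A\<close> is written with the scalar
      -1 so that homogeneity turns the norm of the second summand into \<open>N A\<close>.\<close>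
    have "c \<cdot>\<^sub>m D = B + (- 1) \<cdot>\<^sub>m A"
      using A D(1) by (intro eq_matI) (auto simp: B_def)
    then have "N (c \<cdot>\<^sub>m D) \<le> N B + N A"
      using triangle[OF B, of "(- 1) \<cdot>\<^sub>m A"] smult[OF A, of "- 1"] A by simp
    then show ?thesis
      using smult[OF D(1), of c] c by simp
  qed
  ultimately show "\<exists>B \<in> carrier_mat m n. B * X = A * X \<and> N B \<ge> \<delta>"
    using B by blast
qed

end
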